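(* Let $G$ be a connected, undirected, weighted graph on $\mathcal{V}=\{1,\dots,N\}$ with Laplacian $\mathbf{L}$, let $\delta>0$, let $\omega>0$, let $\lambda_r$ be the largest eigenvalue of $\mathbf{L}$ less than $\omega$, let $\mathcal{R}=\{1,\dots,r\}$, and let $\hat{\mathbf{K}} = \sum_{i=1}^r \frac{1}{\lambda_i+\delta}\mathbf{u}^i{\mathbf{u}^i}^\top$. Let $\mathcal{S}\subseteq\mathcal{V}$ be a uniqueness set for $PW_\omega(G)$. Then the MAP estimate of $\mathbf{f}_{\mathcal{S}^c}$ given $\mathbf{f}_{\mathcal{S}}$ in a Gaussian random field with covariance matrix $\hat{\mathbf{K}}$ is equal to the bandlimited reconstruction of $\mathbf{f}_{\mathcal{S}^c}$ from $\mathbf{f}_{\mathcal{S}}$; that is, $$\hat{\mathbf{K}}_{\mathcal{S}^c\mathcal{S}}\,(\hat{\mathbf{K}}_{\mathcal{S}})^{+}\,\mathbf{f}_{\mathcal{S}} \;=\; \mathbf{U}_{\mathcal{S}^c\mathcal{R}}\,(\mathbf{U}_{\mathcal{S}\mathcal{R}}^\top\mathbf{U}_{\mathcal{S}\mathcal{R}})^{-1}\,\mathbf{U}_{\mathcal{S}\mathcal{R}}^\top\,\mathbf{f}_{\mathcal{S}}.$$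
   Context: Graph: $G=(\mathcal{V},\mathcal{E})$ is connected, undirected, with positive edge weights $w_{ij}=w_{ji}$; $\mathbf{W}=(w_{ij})$ is the adjacency matrix (zero entry where there is no edge), $\mathbf{D}=\mathrm{diag}\{d_1,\dots,d_N\}$ with $d_i=\sum_j w_{ij}$, and $\mathbf{L}=\mathbf{D}-\mathbf{W}$. The eigenvalues of $\mathbf{L}$ (with multiplicity) are $0=\lambda_1<\lambda_2\le\dots\le\lambda_N$, with orthonormal eigenvectors $\mathbf{u}^1,\dots,\mathbf{u}^N$, and $\mathbf{U}=(\mathbf{u}^1,\dots,\mathbf{u}^N)$. The index $r$ is the number of eigenvalues less than $\omega$, counted with multiplicity. Notation: for $\mathcal{S}\subseteq\mathcal{V}$, $\mathcal{S}^c=\mathcal{V}\setminus\mathcal{S}$; $\mathbf{x}_{\mathcal{S}}$ is the sub-vector of $\mathbf{x}\in\mathbb{R}^N$ indexed by $\mathcal{S}$; $\mathbf{A}_{\mathcal{S}_1\mathcal{S}_2}$ is the submatrix of $\mathbf{A}$ with rows $\mathcal{S}_1$ and columns $\mathcal{S}_2$, and $\mathbf{A}_{\mathcal{S}}=\mathbf{A}_{\mathcal{S}\mathcal{S}}$; $\mathbf{A}^+$ is the Moore–Penrose pseudo-inverse. Bandlimited signals: a graph signal is a vector $\mathbf{f}\in\mathbb{R}^N$. $PW_\omega(G)$ is the space of $\omega$-bandlimited signals, i.e. those $\mathbf{f}$ with $\langle \mathbf{f},\mathbf{u}^i\rangle=0$ whenever $\lambda_i>\omega$. A set $\mathcal{S}\subseteq\mathcal{V}$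 is a uniqueness set for $PW_\omega(G)$ if every signal in $PW_\omega(G)$ is uniquely determined by its samples on $\mathcal{S}$: $\mathbf{f},\mathbf{g}\in PW_\omega(G)$ and $\mathbf{f}_{\mathcal{S}}=\mathbf{g}_{\mathcal{S}}$ imply $\mathbf{f}=\mathbf{g}$. Bandlimited (least squares) reconstruction: given $\mathbf{f}_{\mathcal{S}}$, with $\mathcal{S}$ a uniqueness set (so that $\mathbf{U}_{\mathcal{S}\mathcal{R}}$ has full column rank), the bandlimited reconstruction of the samples on $\mathcal{S}^c$ is $\mathbf{U}_{\mathcal{S}^c\mathcal{R}}(\mathbf{U}_{\mathcal{S}\mathcal{R}}^\top\mathbf{U}_{\mathcal{S}\mathcal{R}})^{-1}\mathbf{U}_{\mathcal{S}\mathcal{R}}^\top\mathbf{f}_{\mathcal{S}}$. MAP estimate: in a zero-mean Gaussian random field with (possibly singular) covariance matrix $\mathbf{C}$, the MAP estimate of $\mathbf{f}_{\mathcal{S}^c}$ given $\mathbf{f}_{\mathcal{S}}$ is the conditional mean $\mathbf{C}_{\mathcal{S}^c\mathcal{S}}(\mathbf{C}_{\mathcal{S}})^{+}\mathbf{f}_{\mathcal{S}}$. *)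

theory Defs
  imports
    "Graph_Theory.Pair_Digraph"
    "Graph_Theory.Digraph_Component"
    "Jordan_Normal_Form.Char_Poly"
    "Jordan_Normal_Form.Gauss_Jordan_Elimination"
    "Jordan_Normal_Form.DL_Submatrix"
begin

text \<open>
  Vertices, eigenvalues and eigenvectors are numbered from 0, as are the indices of vectors and
  matrices: the vertex set \<open>{1,\<dots>,N}\<close> becomes \<open>{0..<N}\<close>, and \<open>\<R> = {1,\<dots>,r}\<close> becomes \<open>{0..<r}\<close>.
\<close>

text \<open>
  An undirected edge is a pair of opposite arcs. Loops are not excluded; they do not affect the
  Laplacian. Connectedness includes that the graph has at least one vertex.
\<close>

locale connected_weighted_graph = pair_pseudo_graph G
  for G :: "nat pair_pre_digraph" +
  fixes N :: nat and w :: "nat \<Rightarrow> nat \<Rightarrow> real"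
  assumes vertices: "pverts G = {0..<N}"
    and connected: "Digraph_Component.connected (with_proj G)"
    and weight_pos: "\<And>i j. (i, j) \<in> parcs G \<Longrightarrow> 0 < w i j"
    and weight_sym: "\<And>i j. (i, j) \<in> parcs G \<Longrightarrow> w i j = w j i"

text \<open>The weight function is only consulted on edges.\<close>

definition adjacency_mat :: "nat pair_pre_digraph \<Rightarrow> nat \<Rightarrow> (nat \<Rightarrow> nat \<Rightarrow> real) \<Rightarrow> real mat" where
  "adjacency_mat G N w = mat N N (\<lambda>(i, j). if (i, j) \<in> parcs G then w i j else 0)"

definition degree_mat :: "real mat \<Rightarrow> real mat" where
  "degree_mat W = mat (dim_row W) (dim_row W)
     (\<lambda>(i, j). if i = j then \<Sum>k<dim_col W. W $$ (i, k) else 0)"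

definition laplacian :: "nat pair_pre_digraph \<Rightarrow> nat \<Rightarrow> (nat \<Rightarrow> nat \<Rightarrow> real) \<Rightarrow> real mat" where
  "laplacian G N w = degree_mat (adjacency_mat G N w) - adjacency_mat G N w"

text \<open>
  As there are \<open>N\<close> orthonormal eigenvectors of an \<open>N \<times> N\<close> matrix,
  \<open>ev 0 \<le> \<dots> \<le> ev (N - 1)\<close> lists all its eigenvalues with multiplicity.
\<close>

definition orthonormal_eigenbasis ::
  "real mat \<Rightarrow> nat \<Rightarrow> (nat \<Rightarrow> real) \<Rightarrow> (nat \<Rightarrow> real vec) \<Rightarrow> bool" where
  "orthonormal_eigenbasis L N ev u \<longleftrightarrow>
     L \<in> carrier_mat N N \<and>
     (\<forall>i<N. eigenvector L (u i) (ev i)) \<and>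
     (\<forall>i<N. \<forall>j<N. u i \<bullet> u j = (if i = j then 1 else 0)) \<and>
     (\<forall>i j. i \<le> j \<and> j < N \<longrightarrow> ev i \<le> ev j)"

definition eigenvector_mat :: "nat \<Rightarrow> (nat \<Rightarrow> real vec) \<Rightarrow> real mat" where
  "eigenvector_mat N u = mat_of_cols N (map u [0..<N])"

definition paley_wiener ::
  "nat \<Rightarrow> (nat \<Rightarrow> real) \<Rightarrow> (nat \<Rightarrow> real vec) \<Rightarrow> real \<Rightarrow> real vec set" where
  "paley_wiener N ev u \<omega> = {f \<in> carrier_vec N. \<forall>i<N. ev i > \<omega> \<longrightarrow> f \<bullet> u i = 0}"

text \<open>Same convention as \<^const>\<open>submatrix\<close>: entries are kept in increasing order of their index.\<close>

definition subvector :: "'a vec \<Rightarrow> nat set \<Rightarrow> 'a vec" where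
  "subvector x S = vec (card {i. i < dim_vec x \<and> i \<in> S}) (\<lambda>k. x $ pick S k)"

definition uniqueness_set :: "nat set \<Rightarrow> real vec set \<Rightarrow> bool" where
  "uniqueness_set S PW \<longleftrightarrow>
     (\<forall>f\<in>PW. \<forall>g\<in>PW. subvector f S = subvector g S \<longrightarrow> f = g)"

definition is_pseudoinverse :: "real mat \<Rightarrow> real mat \<Rightarrow> bool" where
  "is_pseudoinverse A X \<longleftrightarrow>
     X \<in> carrier_mat (dim_col A) (dim_row A) \<and>
     A * X * A = A \<and> X * A * X = X \<and>
     transpose_mat (A * X) = A * X \<and> transpose_mat (X * A) = X * A"

definition pseudoinverse :: "real mat \<Rightarrow> real mat" where
  "pseudoinverse A = (THE X. is_pseudoinverse A X)"

text \<open>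
  Conditional mean of the coordinates outside \<open>S\<close> of a zero-mean Gaussian vector with (possibly
  singular) covariance matrix \<open>C\<close>, given the value \<open>x\<close> of the coordinates in \<open>S\<close>.
\<close>

definition map_estimate :: "real mat \<Rightarrow> nat set \<Rightarrow> real vec \<Rightarrow> real vec" where
  "map_estimate C S x =
     (submatrix C ({0..<dim_row C} - S) S * pseudoinverse (submatrix C S S)) *\<^sub>v x"

text \<open>
  \<^const>\<open>mat_inverse\<close> returns \<^const>\<open>None\<close> on singular matrices, so the value is only specified when
  \<^term>\<open>submatrix U S R\<close> has full column rank.
\<close>

definition bandlimited_reconstruction ::
  "real mat \<Rightarrow> nat set \<Rightarrow> nat set \<Rightarrow> real vec \<Rightarrow> real vec" where
  "bandlimited_reconstruction U R S x =
     (submatrix U ({0..<dim_row U} - S) R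
       * the (mat_inverse (transpose_mat (submatrix U S R) * submatrix U S R))
       * transpose_mat (submatrix U S R)) *\<^sub>v x"

text \<open>
  The sum over \<open>i < r\<close> of the matrices \<open>1 / (ev i + \<delta>) u\<^sup>i (u\<^sup>i)\<^sup>T\<close>, given entry by entry because
  \<^typ>\<open>real mat\<close> carries no type-class addition with a neutral element.
\<close>

definition bandlimited_kernel ::
  "nat \<Rightarrow> (nat \<Rightarrow> real) \<Rightarrow> (nat \<Rightarrow> real vec) \<Rightarrow> real \<Rightarrow> nat \<Rightarrow> real mat" where
  "bandlimited_kernel N ev u \<delta> r =
     mat N N (\<lambda>(a, b). \<Sum>i<r. 1 / (ev i + \<delta>) * (u i $ a * u i $ b))"

end

theory Submission
  imports Defs
begin

text \<open>
  Put \<open>A = U\<^bsub>SR\<^esub>\<close>, \<open>B = U\<^bsub>S\<^sup>cR\<^esub>\<close> and let \<open>\<Sigma>\<close> be the diagonal matrix of the \<open>1 / (\<lambda>\<^sub>i + \<delta>)\<close>, so that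
  the two blocks of the kernel are \<open>A \<Sigma> A\<^sup>T\<close> and \<open>B \<Sigma> A\<^sup>T\<close>. The Laplacian is positive semidefinite,
  hence \<open>\<Sigma>\<close> is invertible, and the uniqueness property makes \<open>A\<close> injective, hence
  \<open>M = A\<^sup>T A\<close> is invertible. Then \<open>A M\<^sup>-\<^sup>1 \<Sigma>\<^sup>-\<^sup>1 M\<^sup>-\<^sup>1 A\<^sup>T\<close> satisfies the Penrose equations for
  \<open>A \<Sigma> A\<^sup>T\<close>, and multiplying it by \<open>B \<Sigma> A\<^sup>T\<close> leaves \<open>B M\<^sup>-\<^sup>1 A\<^sup>T\<close>.
\<close>

section \<open>Pseudoinverses\<close>

text \<open>Hypotheses on dimensions instead of carriers let the simplifier use associativity as a
  rewrite rule.\<close>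

lemma mult_mat_assoc_dim:
  fixes A B C :: "'a :: semiring_0 mat"
  assumes "dim_col A = dim_row B" and "dim_col B = dim_row C"
  shows "A * B * C = A * (B * C)"
  using assms by (intro assoc_mult_mat[of A "dim_row A" "dim_row B" B "dim_row C" C "dim_col C"]) auto

lemma transpose_mult_dim:
  fixes A B :: "'a :: comm_semiring_0 mat"
  assumes "dim_col A = dim_row B"
  shows "transpose_mat (A * B) = transpose_mat B * transpose_mat A"
  using assms by (intro transpose_mult[of A "dim_row A" "dim_row B" B "dim_col B"]) auto

text \<open>\<open>A * X\<close> and \<open>A * Y\<close> are both the orthogonal projection onto
  the column space of \<open>A\<close>: each fixes the other from the left, and transposing one of
  these identities, with both factors symmetric, makes them equal. The same works for the row
  space.\<close>

lemma mult_pseudoinverse_unique: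
  assumes "is_pseudoinverse A X" and "is_pseudoinverse A Y"
  shows "A * X = A * Y" and "X * A = Y * A"
proof -
  have dims: "dim_row X = dim_col A" "dim_col X = dim_row A"
      "dim_row Y = dim_col A" "dim_col Y = dim_row A"
    and X: "A * X * A = A" "transpose_mat (A * X) = A * X" "transpose_mat (X * A) = X * A"
    and Y: "A * Y * A = A" "transpose_mat (A * Y) = A * Y" "transpose_mat (Y * A) = Y * A"
    using assms by (auto simp: is_pseudoinverse_def)
  have "A * Y * (A * X) = A * X" and "X * A * (Y * A) = X * A"
      and "A * X * (A * Y) = A * Y" and "Y * A * (X * A) = Y * A"
    using mult_mat_assoc_dim[of "A * Y" A X] mult_mat_assoc_dim[of X A "Y * A"]
      mult_mat_assoc_dim[of "A * X" A Y] mult_mat_assoc_dim[of Y A "X * A"]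
      mult_mat_assoc_dim[of A Y A] mult_mat_assoc_dim[of A X A] X(1) Y(1)
    by (simp_all add: dims)
  then show "A * X = A * Y" and "X * A = Y * A"
    using transpose_mult_dim[of "A * X" "A * Y"] transpose_mult_dim[of "Y * A" "X * A"] X Y
    by (simp_all add: dims)
qed

lemma is_pseudoinverse_unique:
  assumes X: "is_pseudoinverse A X" and Y: "is_pseudoinverse A Y"
  shows "X = Y"
proof -
  have dims: "dim_row X = dim_col A" "dim_col X = dim_row A"
      "dim_row Y = dim_col A" "dim_col Y = dim_row A"
    using assms by (auto simp: is_pseudoinverse_def)
  have "X = X * A * X" using X by (simp add: is_pseudoinverse_def)
  also have "\<dots> = Y * (A * X)"
    using mult_pseudoinverse_unique(2)[OF X Y] by (simp add: mult_mat_assoc_dim dims)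
  also have "\<dots> = Y * A * Y"
    using mult_pseudoinverse_unique(1)[OF X Y] by (simp add: mult_mat_assoc_dim dims)
  also have "\<dots> = Y" using Y by (simp add: is_pseudoinverse_def)
  finally show ?thesis .
qed

lemma pseudoinverse_eqI: "is_pseudoinverse A X \<Longrightarrow> pseudoinverse A = X"
  unfolding pseudoinverse_def by (blast intro: is_pseudoinverse_unique)

text \<open>After reassociating to the right, every inverse meets its partner, so the products in
  both orders collapse to \<open>A * M' * transpose_mat A\<close>, the orthogonal projection onto
  the column space of \<open>A\<close>. The second claim leaves out the leftmost factor, so that any
  block can be multiplied on afterwards.\<close>

lemma is_pseudoinverse_congruence:
  fixes A D D' M' :: "real mat"
  assumes A: "A \<in> carrier_mat s r"
    and D: "D \<in> carrier_mat r r" and D': "D' \<in> carrier_mat r r" and M': "M' \<in> carrier_mat r r"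
    and DD': "D * D' = 1\<^sub>m r" and D'D: "D' * D = 1\<^sub>m r"
    and MM': "transpose_mat A * A * M' = 1\<^sub>m r" and M'M: "M' * (transpose_mat A * A) = 1\<^sub>m r"
  shows "is_pseudoinverse (A * D * transpose_mat A) (A * M' * D' * M' * transpose_mat A)"
    and "D * transpose_mat A * (A * M' * D' * M' * transpose_mat A) = M' * transpose_mat A"
proof -
  let ?T = "transpose_mat A"
  let ?K = "A * D * ?T" and ?X = "A * M' * D' * M' * ?T"
  have dims [simp]: "dim_row A = s" "dim_col A = r" "dim_row D = r" "dim_col D = r"
      "dim_row D' = r" "dim_col D' = r" "dim_row M' = r" "dim_col M' = r"
    using A D D' M' by auto
  note assoc = mult_mat_assoc_dim
  \<comment> \<open>The arbitrary tail \<open>Z\<close> lets the cancellation fire inside a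
    right-nested product.\<close>
  have MM'_cancel: "?T * (A * (M' * Z)) = Z" if "dim_row Z = r" for Z
  proof -
    have "?T * (A * (M' * Z)) = ?T * A * M' * Z" using that by (simp add: assoc)
    then show ?thesis using that MM' by simp
  qed
  have M'M_cancel: "M' * (?T * (A * Z)) = Z" if "dim_row Z = r" for Z
  proof -
    have "M' * (?T * (A * Z)) = M' * (?T * A) * Z" using that by (simp add: assoc)
    then show ?thesis using that M'M by simp
  qed
  have DD'_cancel: "D * (D' * Z) = Z" and D'D_cancel: "D' * (D * Z) = Z" if "dim_row Z = r" for Z
    using that DD' D'D by (simp_all flip: assoc)
  note cancel = MM'_cancel M'M_cancel DD'_cancel D'D_cancel
  have gram_sym: "transpose_mat (?T * A) = ?T * A"
    by (simp add: transpose_mult_dim)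
  \<comment> \<open>The transpose of \<open>M'\<close> is a left inverse of the symmetric Gram
    matrix, hence equals its right inverse \<open>M'\<close>.\<close>
  have "transpose_mat M' * (?T * A) = transpose_mat (?T * A * M')"
    by (simp only: transpose_mult_dim[of "?T * A" M'] gram_sym index_mult_mat dims)
  then have "transpose_mat M' * (?T * A) = 1\<^sub>m r" by (simp add: MM')
  then have "1\<^sub>m r * M' = transpose_mat M' * (?T * A * M')"
    using mult_mat_assoc_dim[of "transpose_mat M'" "?T * A" M'] by simp
  then have M'_sym: "transpose_mat M' = M'" using M' by (simp add: MM')
  have KX: "?K * ?X = A * (M' * ?T)" and XK: "?X * ?K = A * (M' * ?T)"
    by (simp_all add: assoc cancel)
  have "transpose_mat (A * (M' * ?T)) = A * (M' * ?T)"
    by (simp add: transpose_mult_dim M'_sym assoc)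
  moreover have "?K * ?X * ?K = ?K" and "?X * ?K * ?X = ?X"
    unfolding KX XK by (simp_all add: assoc cancel)
  ultimately show "is_pseudoinverse ?K ?X"
    unfolding is_pseudoinverse_def KX XK by auto
  show "D * ?T * ?X = M' * ?T" by (simp add: assoc cancel)
qed

text \<open>Over the reals \<open>v \<bullet> (?M *\<^sub>v v)\<close> is the squared norm of
  \<open>A *\<^sub>v v\<close>, so the Gram matrix has the same kernel as \<open>A\<close>.\<close>

lemma mat_inverse_gram:
  fixes A :: "real mat"
  assumes A: "A \<in> carrier_mat s r"
    and inj: "\<And>v. v \<in> carrier_vec r \<Longrightarrow> A *\<^sub>v v = 0\<^sub>v s \<Longrightarrow> v = 0\<^sub>v r"
  obtains M' where "mat_inverse (transpose_mat A * A) = Some M'" and "M' \<in> carrier_mat r r"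
    and "transpose_mat A * A * M' = 1\<^sub>m r" and "M' * (transpose_mat A * A) = 1\<^sub>m r"
proof -
  let ?M = "transpose_mat A * A"
  have M: "?M \<in> carrier_mat r r" using A by auto
  have "v = 0\<^sub>v r" if v: "v \<in> carrier_vec r" and Mv: "?M *\<^sub>v v = 0\<^sub>v r" for v
  proof -
    have Av: "A *\<^sub>v v \<in> carrier_vec s" using A v by auto
    have "?M *\<^sub>v v = transpose_mat A *\<^sub>v (A *\<^sub>v v)"
      using A v by (intro assoc_mult_mat_vec) auto
    then have "(A *\<^sub>v v) \<bullet> (A *\<^sub>v v) = v \<bullet> (?M *\<^sub>v v)"
      using transpose_vec_mult_scalar[OF A v Av] v A Av
      by (metis comm_scalar_prod mult_mat_vec_carrier transpose_carrier_mat)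
    also have "\<dots> = 0" using v Mv by simp
    finally have "A *\<^sub>v v = 0\<^sub>v s" using conjugate_square_eq_0_vec[OF Av] by simp
    then show ?thesis using inj v by blast
  qed
  then have "det ?M \<noteq> 0" using det_0_iff_vec_prod_zero[OF M] by blast
  then have "?M \<in> Units (ring_mat TYPE(real) r ())" by (rule det_non_zero_imp_unit[OF M])
  then obtain M' where "mat_inverse ?M = Some M'"
    using mat_inverse(1)[OF M, of "()"] by (cases "mat_inverse ?M") auto
  then show ?thesis using mat_inverse(2)[OF M] that by blast
qed

section \<open>Eigenvalues of the Laplacian\<close>

text \<open>Symmetrisation: the double sum is added to its copy with \<open>i\<close> and
  \<open>j\<close> exchanged, whence the factor 2.\<close>

lemma laplacian_quadratic_form:
  fixes a :: "nat \<Rightarrow> nat \<Rightarrow> real" and x :: "nat \<Rightarrow> real"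
  assumes "\<And>i j. i < N \<Longrightarrow> j < N \<Longrightarrow> a i j = a j i"
  shows "2 * (\<Sum>i<N. x i * (\<Sum>j<N. a i j * x i - a i j * x j))
       = (\<Sum>i<N. \<Sum>j<N. a i j * (x i - x j)\<^sup>2)"
proof -
  let ?g = "\<lambda>i j. x i * (a i j * x i - a i j * x j)"
  have "(\<Sum>i<N. \<Sum>j<N. ?g i j) = (\<Sum>i<N. \<Sum>j<N. ?g j i)" by (rule sum.swap)
  then have "2 * (\<Sum>i<N. \<Sum>j<N. ?g i j) = (\<Sum>i<N. \<Sum>j<N. ?g i j + ?g j i)"
    by (simp add: sum.distrib)
  also have "\<dots> = (\<Sum>i<N. \<Sum>j<N. a i j * (x i - x j)\<^sup>2)"
    using assms by (intro sum.cong refl) (simp add: algebra_simps power2_eq_square)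
  finally show ?thesis by (simp add: sum_distrib_left)
qed

context connected_weighted_graph
begin

lemma adjacency_nonneg: "0 \<le> (if (i, j) \<in> parcs G then w i j else 0)"
  using weight_pos by (auto intro: less_imp_le)

lemma adjacency_sym:
  "(if (i, j) \<in> parcs G then w i j else 0) = (if (j, i) \<in> parcs G then w j i else 0)"
  using weight_sym pair_sym_arcs by (auto simp: symmetric_def elim: symE)

text \<open>\<open>k * (x \<bullet> x)\<close> is the Laplacian quadratic form at \<open>x\<close>,
  half a sum of nonnegative weighted squares, and \<open>x\<close> is nonzero.\<close>

lemma laplacian_eigenvalue_nonneg:
  assumes "eigenvector (laplacian G N w) x k"
  shows "0 \<le> k"
proof -
  let ?L = "laplacian G N w" and ?a = "\<lambda>i j. if (i, j) \<in> parcs G then w i j else 0"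
  have L_eq: "?L = mat N N (\<lambda>(i, j). (if i = j then \<Sum>l<N. ?a i l else 0) - ?a i j)"
    by (intro eq_matI) (auto simp: laplacian_def degree_mat_def adjacency_mat_def)
  then have L: "?L \<in> carrier_mat N N" by simp
  have x: "x \<in> carrier_vec N" "x \<noteq> 0\<^sub>v N" "?L *\<^sub>v x = k \<cdot>\<^sub>v x"
    using assms L by (auto simp: eigenvector_def)
  have Lx: "(?L *\<^sub>v x) $ i = (\<Sum>j<N. ?a i j * x $ i - ?a i j * x $ j)" if i: "i < N" for i
  proof -
    have "(?L *\<^sub>v x) $ i
        = (\<Sum>j<N. ((if i = j then \<Sum>l<N. ?a i l else 0) - ?a i j) * x $ j)"
      using i x(1) unfolding L_eq by (simp add: scalar_prod_def atLeast0LessThan)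
    also have "\<dots> = (\<Sum>j<N. (if i = j then (\<Sum>l<N. ?a i l) * x $ j else 0)) - (\<Sum>j<N. ?a i j * x $ j)"
      unfolding sum_subtractf[symmetric] by (intro sum.cong refl) (simp add: algebra_simps)
    also have "\<dots> = (\<Sum>j<N. ?a i j * x $ i - ?a i j * x $ j)"
      using i by (simp add: sum_distrib_right sum_subtractf)
    finally show ?thesis .
  qed
  have "x \<bullet> (?L *\<^sub>v x) = (\<Sum>i<N. x $ i * (?L *\<^sub>v x) $ i)"
    using L by (simp add: scalar_prod_def atLeast0LessThan)
  also have "\<dots> = (\<Sum>i<N. x $ i * (\<Sum>j<N. ?a i j * x $ i - ?a i j * x $ j))"
    by (intro sum.cong refl) (simp only: Lx lessThan_iff)
  finally have "2 * (x \<bullet> (?L *\<^sub>v x)) = (\<Sum>i<N. \<Sum>j<N. ?a i j * (x $ i - x $ j)\<^sup>2)"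
    using laplacian_quadratic_form[of N ?a "\<lambda>i. x $ i"] adjacency_sym by simp
  also have "\<dots> \<ge> 0"
    by (intro sum_nonneg mult_nonneg_nonneg adjacency_nonneg zero_le_power2)
  finally have "0 \<le> k * (x \<bullet> x)" using x by simp
  moreover have "0 < x \<bullet> x"
    using conjugate_square_greater_0_vec[OF x(1)] x(2) by simp
  ultimately show ?thesis by (simp add: zero_le_mult_iff)
qed

end

section \<open>Blocks of the kernel and of the eigenvector matrix\<close>

text \<open>Since \<open>ev\<close> is sorted, the indices of eigenvalues below \<omega> form an
  initial segment; this ties the count \<open>r\<close> to the index set
  \<open>{0..<r}\<close>.\<close>

lemma less_card_eigenvalues_below:
  fixes ev :: "nat \<Rightarrow> real"
  assumes mono: "mono_on {..<N} ev"
    and i: "i < card {i. i < N \<and> ev i < \<omega>}"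
  shows "i < N" and "ev i < \<omega>"
proof -
  have "card {i. i < N \<and> ev i < \<omega>} \<le> card {..<N}" by (rule card_mono) auto
  then show "i < N" using i by simp
  show "ev i < \<omega>"
  proof (rule ccontr)
    assume "\<not> ev i < \<omega>"
    \<comment> \<open>By monotonicity no index from \<open>i\<close> onwards lies below \<omega>, so
      at most \<open>i\<close> indices are counted.\<close>
    then have "{i. i < N \<and> ev i < \<omega>} \<subseteq> {..<i}"
      using \<open>i < N\<close> monotone_onD[OF mono, of i] by (fastforce simp: not_less intro: leI)
    then have "card {i. i < N \<and> ev i < \<omega>} \<le> card {..<i}" by (intro card_mono) auto
    then show False using i by simp
  qed
qed

lemma pick_atLeast0LessThan:
  assumes "k < r" shows "pick {0..<r} k = k"
proof -
  have "{a \<in> {0..<r}. a < k} = {..<k}" using assms by auto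
  then show ?thesis using pick_card_in_set[of k "{0..<r}"] assms by simp
qed

lemma submatrix_eigenvector_mat:
  assumes "r \<le> N"
  shows "submatrix (eigenvector_mat N u) I {0..<r}
       = mat (card {i. i < N \<and> i \<in> I}) r (\<lambda>(k, i). u i $ pick I k)"
proof -
  have "{i. i < N \<and> i < r} = {..<r}" using assms(1) by auto
  then show ?thesis
    using assms
    by (intro eq_matI)
      (auto simp: submatrix_def eigenvector_mat_def mat_of_cols_def pick_atLeast0LessThan pick_le)
qed

text \<open>Restricted form of the spectral factorisation of the kernel. Independent
  \<open>I\<close> and \<open>J\<close> cover both blocks of the MAP estimate.\<close>

lemma submatrix_bandlimited_kernel:
  assumes "r \<le> N"
  shows "submatrix (bandlimited_kernel N ev u \<delta> r) I J
       = submatrix (eigenvector_mat N u) I {0..<r} * mat_diag r (\<lambda>i. 1 / (ev i + \<delta>))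
         * transpose_mat (submatrix (eigenvector_mat N u) J {0..<r})"
  unfolding submatrix_eigenvector_mat[OF assms]
    mat_diag_mult_right[OF mat_carrier[of "card {i. i < N \<and> i \<in> I}" r]]
  by (intro eq_matI)
    (auto simp: submatrix_def bandlimited_kernel_def pick_le scalar_prod_def atLeast0LessThan
      ac_simps intro!: sum.cong)

text \<open>A kernel vector \<open>c\<close> lists the coefficients of a bandlimited signal
  \<open>g\<close> that vanishes on \<open>S\<close>. Uniqueness against the zero signal gives
  \<open>g = 0\<close>, and orthonormality then recovers each coefficient as zero.\<close>

lemma uniqueness_set_imp_injective:
  assumes u: "\<And>i. i < N \<Longrightarrow> u i \<in> carrier_vec N"
    and orth: "\<And>i j. i < N \<Longrightarrow> j < N \<Longrightarrow> u i \<bullet> u j = (if i = j then 1 else 0)"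
    and r: "r \<le> N" and ev: "\<And>i. i < r \<Longrightarrow> ev i \<le> \<omega>"
    and uniq: "uniqueness_set S (paley_wiener N ev u \<omega>)"
    and c: "c \<in> carrier_vec r"
    and zero: "submatrix (eigenvector_mat N u) S {0..<r} *\<^sub>v c = 0\<^sub>v (card {i. i < N \<and> i \<in> S})"
  shows "c = 0\<^sub>v r"
proof -
  let ?s = "card {i. i < N \<and> i \<in> S}"
  define g where "g = vec N (\<lambda>a. \<Sum>i<r. c $ i * u i $ a)"
  have gu: "g \<bullet> u j = (if j < r then c $ j else 0)" if j: "j < N" for j
  proof -
    have "g \<bullet> u j = (\<Sum>a<N. \<Sum>i<r. c $ i * (u i $ a * u j $ a))"
      using u[OF j] by (simp add: g_def scalar_prod_def atLeast0LessThan sum_distrib_right mult.assoc)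
    also have "\<dots> = (\<Sum>i<r. c $ i * (u i \<bullet> u j))"
      using u[OF j] by (subst sum.swap) (simp add: scalar_prod_def atLeast0LessThan sum_distrib_left)
    also have "\<dots> = (\<Sum>i<r. if i = j then c $ j else 0)"
      using r j by (intro sum.cong refl) (auto simp: orth)
    finally show ?thesis by simp
  qed
  \<comment> \<open>An eigenvalue above \<omega> has index at least \<open>r\<close>, where the
    coefficient of \<open>g\<close> is 0.\<close>
  have "g \<in> paley_wiener N ev u \<omega>"
    using gu ev by (force simp: paley_wiener_def g_def)
  moreover have "0\<^sub>v N \<in> paley_wiener N ev u \<omega>"
    using u by (auto simp: paley_wiener_def)
  moreover have "subvector g S = subvector (0\<^sub>v N) S"
  proof (rule eq_vecI)
    fix k assume "k < dim_vec (subvector (0\<^sub>v N :: real vec) S)"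
    then have k: "k < ?s" by (simp add: subvector_def)
    have "subvector g S $ k = (submatrix (eigenvector_mat N u) S {0..<r} *\<^sub>v c) $ k"
      unfolding submatrix_eigenvector_mat[OF r] using k c
      by (auto simp: subvector_def g_def pick_le scalar_prod_def atLeast0LessThan mult.commute
          intro!: sum.cong)
    then show "subvector g S $ k = subvector (0\<^sub>v N) S $ k"
      using k zero by (simp add: subvector_def pick_le)
  qed (simp add: subvector_def g_def)
  ultimately have "g = 0\<^sub>v N" using uniq by (auto simp: uniqueness_set_def)
  then have "c $ j = 0" if "j < r" for j
    using gu[of j] u[of j] r that by simp
  then show ?thesis using c by (intro eq_vecI) auto
qed

theorem lemma1:
  fixes G :: "nat pair_pre_digraph" and N r :: nat and w :: "nat \<Rightarrow> nat \<Rightarrow> real"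
    and ev :: "nat \<Rightarrow> real" and u :: "nat \<Rightarrow> real vec"
    and \<delta> \<omega> :: real and S :: "nat set" and f :: "real vec"
  assumes "connected_weighted_graph G N w"
    and "orthonormal_eigenbasis (laplacian G N w) N ev u"
    and "\<delta> > 0" and "\<omega> > 0"
    and "r = card {i. i < N \<and> ev i < \<omega>}"
    and "S \<subseteq> {0..<N}"
    and "uniqueness_set S (paley_wiener N ev u \<omega>)"
    and "f \<in> carrier_vec N"
  shows "map_estimate (bandlimited_kernel N ev u \<delta> r) S (subvector f S)
       = bandlimited_reconstruction (eigenvector_mat N u) {0..<r} S (subvector f S)"
proof -
  interpret connected_weighted_graph G N w by fact
  let ?U = "eigenvector_mat N u" and ?K = "bandlimited_kernel N ev u \<delta> r"
  have eig: "\<And>i. i < N \<Longrightarrow> eigenvector (laplacian G N w) (u i) (ev i)"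
    and L: "laplacian G N w \<in> carrier_mat N N"
    and orth: "\<And>i j. i < N \<Longrightarrow> j < N \<Longrightarrow> u i \<bullet> u j = (if i = j then 1 else 0)"
    and mono: "mono_on {..<N} ev"
    using assms(2) by (auto simp: orthonormal_eigenbasis_def monotone_on_def)
  have u: "u i \<in> carrier_vec N" if "i < N" for i
    using eig[OF that] L by (auto simp: eigenvector_def)
  have below: "i < N" "ev i < \<omega>" if "i < r" for i
    using less_card_eigenvalues_below[OF mono, of i \<omega>] that assms(5) by auto
  have r: "r \<le> N" using below(1) by (meson leI less_irrefl)
  have pos: "0 < ev i + \<delta>" if "i < r" for i
    using laplacian_eigenvalue_nonneg[OF eig] below(1)[OF that] \<open>\<delta> > 0\<close> by (simp add: add_nonneg_pos)
  define s A B D D' where "s = card {i. i < N \<and> i \<in> S}"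
    and "A = submatrix ?U S {0..<r}" and "B = submatrix ?U ({0..<N} - S) {0..<r}"
    and "D = mat_diag r (\<lambda>i. 1 / (ev i + \<delta>))" and "D' = mat_diag r (\<lambda>i. ev i + \<delta>)"
  have A: "A \<in> carrier_mat s r"
    by (simp add: A_def s_def submatrix_eigenvector_mat[OF r])
  have B: "dim_col B = r"
    by (simp add: B_def submatrix_eigenvector_mat[OF r])
  have D: "D \<in> carrier_mat r r" "D' \<in> carrier_mat r r" by (simp_all add: D_def D'_def)
  \<comment> \<open>Positivity of \<open>ev i + \<delta>\<close> keeps the reciprocals in
    \<open>D\<close> away from division by zero.\<close>
  have DD': "D * D' = 1\<^sub>m r" "D' * D = 1\<^sub>m r"
    using less_imp_neq[OF pos]
    by (auto simp: D_def D'_def, auto simp: mat_diag_def intro!: eq_matI)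
  \<comment> \<open>\<open>r\<close> counts eigenvalues strictly below \<omega>, while the signal
    space also admits \<omega> itself; the span of the first \<open>r\<close> eigenvectors is
    contained in that space, which suffices for injectivity.\<close>
  have "c = 0\<^sub>v r" if "c \<in> carrier_vec r" "A *\<^sub>v c = 0\<^sub>v s" for c
    using u orth r less_imp_le[OF below(2)] assms(7) that
    by (rule uniqueness_set_imp_injective[of N u r ev \<omega> S c, folded A_def s_def])
  then obtain M' where inv: "mat_inverse (transpose_mat A * A) = Some M'"
    and M': "M' \<in> carrier_mat r r"
    and MM': "transpose_mat A * A * M' = 1\<^sub>m r" "M' * (transpose_mat A * A) = 1\<^sub>m r"
    using mat_inverse_gram[OF A] by metis
  note pinv = is_pseudoinverse_congruence[OF A D M' DD' MM']
  have K: "submatrix ?K S S = A * D * transpose_mat A"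
      "submatrix ?K ({0..<N} - S) S = B * D * transpose_mat A"
    by (simp_all add: A_def B_def D_def submatrix_bandlimited_kernel[OF r])
  have dims: "dim_row ?K = N" "dim_row ?U = N"
    by (simp_all add: bandlimited_kernel_def eigenvector_mat_def)
  \<comment> \<open>Splitting \<open>B\<close> off on the left exposes the product evaluated by
    \<open>pinv(2)\<close>.\<close>
  have "B * D * transpose_mat A * (A * M' * D' * M' * transpose_mat A)
      = B * (D * transpose_mat A * (A * M' * D' * M' * transpose_mat A))"
    using A B D M' by (simp add: mult_mat_assoc_dim)
  also have "\<dots> = B * M' * transpose_mat A"
    unfolding pinv(2) using A B M' by (simp add: mult_mat_assoc_dim)
  finally show ?thesis
    unfolding map_estimate_def bandlimited_reconstruction_def dims K
      pseudoinverse_eqI[OF pinv(1)] A_def[symmetric] B_def[symmetric] inv option.sel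
    by simp
qed

end
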